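(* Let $\mathcal{A}=\{A_1,\ldots,A_m\}$ be an arrangement of finite cameras with pairwise distinct centers, and assume that the chiral domain $D_\mathcal{A}$ is nonempty. (1) If the camera centers are in general position, i.e. $E^0_\mathcal{A}=\emptyset$, then $\overline{\mathcal{J}}_\mathcal{A}\cap C_\mathcal{A}=\overline{\mathcal{X}}_\mathcal{A}$. (2) If $E^0_\mathcal{A}\ne\emptyset$ and the camera centers are not collinear, then $$\overline{\mathcal{J}}_\mathcal{A}\cap C_\mathcal{A}=\mathcal{X}_\mathcal{A}\cup E^+_\mathcal{A}=\overline{\mathcal{X}}_\mathcal{A}\cup E^0_\mathcal{A}.$$ (3) If the camera centers are collinear, then $$\overline{\mathcal{J}}_\mathcal{A}\cap C_\mathcal{A}=\mathcal{X}_\mathcal{A}\cup E^+_\mathcal{A}\cup\{\mathbf{e}\}=\overline{\mathcal{X}}_\mathcal{A}\cup E^0_\mathcal{A}\cup\{\mathbf{e}\},$$ where $\mathbf{e}=(\mathbf{e}_1,\ldots,\mathbf{e}_m)\in(\mathbb{P}^2)^m$ is the image under $\varphi_\mathcal{A}$ of the common baseline, i.e. of the line through all the centers.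
   Context: $\mathbb{P}^n=(\mathbb{R}^{n+1}\setminus\{0\})/\!\sim$ is real projective space with the quotient topology from the Euclidean topology; $(\mathbb{P}^2)^m$ has the product topology; overlines denote closure in this topology. A point $\mathbf{q}\in\mathbb{P}^3$ is finite if $q_4\ne0$; $\mathbf{n}_\infty=(0,0,0,1)^\top$. A camera is a rank-3 matrix $A_i=[\,G_i\ \ \mathbf{t}_i\,]\in\mathbb{R}^{3\times4}$; it is finite if $\det G_i\ne0$. Its center is $\mathbf{c}_i=(-G_i^{-1}\mathbf{t}_i;\,1)$, viewed in $\mathbb{P}^3$. Its principal ray is $\mathbf{n}_i=\det(G_i)(A_i)_{3,\bullet}^\top$, with $(A_i)_{3,\bullet}$ the third row. For finite $\mathbf{q}$, $\operatorname{depth}(\mathbf{q};A_i)=\frac{1}{|\det G_i|\,\|(G_i)_{3,\bullet}\|}\cdot\frac{\mathbf{n}_i^\top\mathbf{q}}{\mathbf{n}_\infty^\top\mathbf{q}}$. The chiral domain $D_\mathcal{A}$ is the closure in $\mathbb{P}^3$ of the set of finite points having positive depth in every camera of $\mathcal{A}$. Let $\varphi_\mathcal{A}(\mathbf{q})=(A_1\mathbf{q},\ldots,A_m\mathbf{q})\in(\mathbb{P}^2)^m$, defined for $\mathbf{q}\in\mathbb{P}^3\setminus\{\mathbf{c}_1,\ldots,\mathbf{c}_m\}$. The joint image $\mathcal{J}_\mathcal{A}$ is the image of $\varphi_\mathcal{A}$; the chiral joint image is $\mathcal{X}_\mathcal{A}=\varphi_\mathcal{A}(D_\mathcal{A})$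 (i.e. the image of $D_\mathcal{A}\setminus\{\mathbf{c}_1,\ldots,\mathbf{c}_m\}$). When all centers lie on one line, all points of that line other than centers have the same image $\mathbf{e}$ under $\varphi_\mathcal{A}$. For $i\neq j$, $\mathbf{e}_{ij}=A_i\mathbf{c}_j\in\mathbb{P}^2$. Let $E_j=\{(\mathbf{p}_1,\ldots,\mathbf{p}_m)\in(\mathbb{P}^2)^m:\mathbf{p}_i=\mathbf{e}_{ij}\ \forall i\ne j\}$ (with $\mathbf{p}_j$ arbitrary). Let $E^+_\mathcal{A}$ be the union of all $E_j$ with $\mathbf{c}_j\in D_\mathcal{A}$, and $E^0_\mathcal{A}$ the union of all $E_j$ such that $\mathbf{c}_j\in D_\mathcal{A}$ and $\operatorname{depth}(\mathbf{c}_j;A_i)=0$ for some $i\neq j$. $C_\mathcal{A}$ is the set of all $\mathbf{p}=(\mathbf{p}_1,\ldots,\mathbf{p}_m)\in(\mathbb{P}^2)^m$ such that for all $i\ne j$ $$\det(G_i)\,p_{i3}\,(\mathbf{a}_i\times\mathbf{a}_j)^\top(\mathbf{b}_{ij}\times\mathbf{a}_j)\ge0,\qquad \det(G_i)\det(G_j)\,p_{i3}\,p_{j3}\,(\mathbf{b}_{ij}\times\mathbf{a}_i)^\top(\mathbf{b}_{ij}\times\mathbf{a}_j)\ge0,$$ where $\mathbf{b}_{ij}=G_i^{-1}\mathbf{t}_i-G_j^{-1}\mathbf{t}_j$, $\mathbf{a}_i=G_i^{-1}\mathbf{p}_i$, and $p_{i3}$ is the third coordinate of $\mathbf{p}_i$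 (the inequalities have even degree in each $\mathbf{p}_i$, hence are well defined).
   Formalization: (1) and the first equality of (2), false as stated, are proved if no baseline's ideal point d has opposite-sign principal-ray values in its two cameras and value zero in all cameras centered off it; for (1) with collinear centers, if the common baseline meets the chiral domain. *)

theory Defs
  imports "HOL-Analysis.Analysis"
begin

definition proj_rel :: "real^'n \<Rightarrow> real^'n \<Rightarrow> bool" where
  "proj_rel u v \<longleftrightarrow> u \<noteq> 0 \<and> v \<noteq> 0 \<and> (\<exists>k. k \<noteq> 0 \<and> u = k *\<^sub>R v)"

lemma part_equivp_proj_rel: "part_equivp (proj_rel :: real^'n \<Rightarrow> real^'n \<Rightarrow> bool)"
proof (rule part_equivpI)
  have "proj_rel (axis undefined 1 :: real^'n) (axis undefined 1)"
    unfolding proj_rel_def by (auto simp: axis_eq_0_iff intro: exI[of _ 1])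
  then show "\<exists>x::real^'n. proj_rel x x" ..
  show "symp (proj_rel :: real^'n \<Rightarrow> real^'n \<Rightarrow> bool)"
    unfolding symp_def proj_rel_def
    by (metis inverse_nonzero_iff_nonzero left_inverse scaleR_one scaleR_scaleR)
  show "transp (proj_rel :: real^'n \<Rightarrow> real^'n \<Rightarrow> bool)"
    unfolding transp_def proj_rel_def by (metis no_zero_divisors scaleR_scaleR)
qed

text \<open>The index type is the type of homogeneous coordinates: \<open>4 proj\<close> is projective
  3-space and \<open>3 proj\<close> is the projective plane.\<close>

quotient_type 'n proj = "real^('n::finite)" / partial: proj_rel
  by (rule part_equivp_proj_rel)

text \<open>\<open>pt v\<close> is unspecified for \<open>v = 0\<close>; \<open>rep q\<close> is an arbitrary choice of homogeneous
  coordinates for \<open>q\<close>.\<close>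

definition pt :: "real^'n \<Rightarrow> 'n::finite proj" where
  "pt v = abs_proj v"

definition rep :: "'n::finite proj \<Rightarrow> real^'n" where
  "rep q = rep_proj q"

lemma proj_rel_rep: "proj_rel (rep q) (rep q)"
  unfolding rep_def by (rule Quotient3_rep_reflp[OF Quotient3_proj])

lemma rep_nonzero [simp]: "rep q \<noteq> 0"
  using proj_rel_rep[of q] by (simp add: proj_rel_def)

lemma pt_rep [simp]: "pt (rep q) = q"
  unfolding pt_def rep_def by (rule Quotient3_abs_rep[OF Quotient3_proj])

lemma pt_eq_iff:
  assumes "u \<noteq> 0" "v \<noteq> 0"
  shows "pt u = pt v \<longleftrightarrow> (\<exists>k. k \<noteq> 0 \<and> u = k *\<^sub>R v)"
proof -
  have refl: "proj_rel w w" if "w \<noteq> 0" for w :: "real^'n"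
    using that unfolding proj_rel_def by (auto intro: exI[of _ 1])
  then have "proj_rel u v \<longleftrightarrow> pt u = pt v"
    using Quotient3_rel[OF Quotient3_proj, of u v] assms unfolding pt_def by auto
  then show ?thesis using assms by (simp add: proj_rel_def)
qed

lemma rep_pt:
  assumes "v \<noteq> 0"
  shows "\<exists>k. k \<noteq> 0 \<and> rep (pt v) = k *\<^sub>R v"
  using pt_eq_iff[OF rep_nonzero assms, of "pt v"] by simp

text \<open>The quotient topology. The set of nonzero vectors is open, so openness of the
  preimage in the whole space is the same as openness relative to the nonzero vectors.\<close>

instantiation proj :: (finite) topological_space
begin

definition open_proj :: "'a proj set \<Rightarrow> bool" where
  "open_proj U \<longleftrightarrow> open {v. v \<noteq> 0 \<and> pt v \<in> U}"

instance
proof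
  have "{v::real^'a. v \<noteq> 0 \<and> pt v \<in> UNIV} = - {0}" by auto
  moreover have "open (- {0 :: real^'a})" by (intro open_Compl closed_singleton)
  ultimately show "open (UNIV :: 'a proj set)" unfolding open_proj_def by metis
next
  fix S T :: "'a proj set"
  assume "open S" "open T"
  moreover have "{v. v \<noteq> 0 \<and> pt v \<in> S \<inter> T} = {v. v \<noteq> 0 \<and> pt v \<in> S} \<inter> {v. v \<noteq> 0 \<and> pt v \<in> T}"
    by auto
  ultimately show "open (S \<inter> T)" unfolding open_proj_def by auto
next
  fix K :: "'a proj set set"
  assume "\<forall>S\<in>K. open S"
  moreover have "{v. v \<noteq> 0 \<and> pt v \<in> \<Union>K} = (\<Union>S\<in>K. {v. v \<noteq> 0 \<and> pt v \<in> S})"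
    by auto
  ultimately show "open (\<Union>K)" unfolding open_proj_def by auto
qed

end

definition proj_line :: "'n::finite proj set \<Rightarrow> bool" where
  "proj_line L \<longleftrightarrow> (\<exists>S. subspace S \<and> dim S = 2 \<and> L = pt ` (S - {0}))"

type_synonym camera = "real^4^3"

definition left_block :: "camera \<Rightarrow> real^3^3" where
  "left_block A = (\<chi> i. vector [A $ i $ 1, A $ i $ 2, A $ i $ 3])"

definition last_col :: "camera \<Rightarrow> real^3" where
  "last_col A = (\<chi> i. A $ i $ 4)"

definition finite_camera :: "camera \<Rightarrow> bool" where
  "finite_camera A \<longleftrightarrow> rank A = 3 \<and> det (left_block A) \<noteq> 0"

definition center_vec :: "camera \<Rightarrow> real^4" where
  "center_vec A =
    (let c = - (matrix_inv (left_block A) *v last_col A) in vector [c $ 1, c $ 2, c $ 3, 1])"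

definition center :: "camera \<Rightarrow> 4 proj" where
  "center A = pt (center_vec A)"

definition principal_ray :: "camera \<Rightarrow> real^4" where
  "principal_ray A = det (left_block A) *\<^sub>R (A $ 3)"

definition n_inf :: "real^4" where
  "n_inf = vector [0, 0, 0, 1]"

definition finite_point :: "4 proj \<Rightarrow> bool" where
  "finite_point q \<longleftrightarrow> rep q $ 4 \<noteq> 0"

text \<open>Meaningful for finite points only; homogeneous of degree 0 in \<open>rep q\<close>.\<close>

definition depth :: "4 proj \<Rightarrow> camera \<Rightarrow> real" where
  "depth q A = 1 / (\<bar>det (left_block A)\<bar> * norm (left_block A $ 3))
     * ((principal_ray A \<bullet> rep q) / (n_inf \<bullet> rep q))"

definition chiral_domain :: "(camera^'m) \<Rightarrow> 4 proj set" where
  "chiral_domain A = closure {q. finite_point q \<and> (\<forall>i. depth q (A $ i) > 0)}"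

definition centers :: "(camera^'m) \<Rightarrow> 4 proj set" where
  "centers A = range (\<lambda>i. center (A $ i))"

text \<open>Meaningful away from the center of the camera.\<close>

definition cam_image :: "camera \<Rightarrow> 4 proj \<Rightarrow> 3 proj" where
  "cam_image A q = pt (A *v rep q)"

text \<open>The topology of \<open>(3 proj)^'m\<close> is the product topology.\<close>

definition phi :: "(camera^'m) \<Rightarrow> 4 proj \<Rightarrow> (3 proj)^'m" where
  "phi A q = (\<chi> i. cam_image (A $ i) q)"

definition joint_image :: "(camera^'m) \<Rightarrow> ((3 proj)^'m) set" where
  "joint_image A = phi A ` (- centers A)"

definition chiral_joint_image :: "(camera^'m) \<Rightarrow> ((3 proj)^'m) set" where
  "chiral_joint_image A = phi A ` (chiral_domain A - centers A)"

definition epipole :: "(camera^'m) \<Rightarrow> 'm \<Rightarrow> 'm \<Rightarrow> 3 proj" where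
  "epipole A i j = cam_image (A $ i) (center (A $ j))"

definition E_set :: "(camera^'m) \<Rightarrow> 'm \<Rightarrow> ((3 proj)^'m) set" where
  "E_set A j = {p. \<forall>i. i \<noteq> j \<longrightarrow> p $ i = epipole A i j}"

definition E_plus :: "(camera^'m) \<Rightarrow> ((3 proj)^'m) set" where
  "E_plus A = \<Union> {E_set A j | j. center (A $ j) \<in> chiral_domain A}"

definition E_zero :: "(camera^'m) \<Rightarrow> ((3 proj)^'m) set" where
  "E_zero A = \<Union> {E_set A j | j. center (A $ j) \<in> chiral_domain A \<and>
     (\<exists>i. i \<noteq> j \<and> depth (center (A $ j)) (A $ i) = 0)}"

text \<open>The inequalities are of even degree in each \<open>rep (p $ i)\<close>, hence independent of the
  chosen homogeneous coordinates.\<close>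

definition C_set :: "(camera^'m) \<Rightarrow> ((3 proj)^'m) set" where
  "C_set A = {p. \<forall>i j. i \<noteq> j \<longrightarrow>
     (let Gi = left_block (A $ i); Gj = left_block (A $ j);
          u = rep (p $ i); v = rep (p $ j);
          b = matrix_inv Gi *v last_col (A $ i) - matrix_inv Gj *v last_col (A $ j);
          ai = matrix_inv Gi *v u; aj = matrix_inv Gj *v v
      in det Gi * u $ 3 * (cross3 ai aj \<bullet> cross3 b aj) \<ge> 0 \<and>
         det Gi * det Gj * u $ 3 * v $ 3 * (cross3 b ai \<bullet> cross3 b aj) \<ge> 0)}"

definition collinear_centers :: "(camera^'m) \<Rightarrow> bool" where
  "collinear_centers A \<longleftrightarrow> (\<exists>L. proj_line L \<and> centers A \<subseteq> L)"

text \<open>For distinct centers, \<open>d\<close> below is the point at infinity of the baseline of \<open>i\<close> and \<open>j\<close>.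
  The baseline is undecided if cameras \<open>i\<close> and \<open>j\<close> see \<open>d\<close> with opposite signs while \<open>d\<close> lies on
  the principal plane of every camera whose center is off the baseline. The image of such a
  \<open>d\<close> satisfies all the inequalities of \<open>C_set\<close>, because each of them vanishes there, although
  \<open>d\<close> is not in the chiral domain.\<close>

definition undecided_baseline :: "(camera^'m) \<Rightarrow> 'm \<Rightarrow> 'm \<Rightarrow> bool" where
  "undecided_baseline A i j \<longleftrightarrow>
     (let d = center_vec (A $ i) - center_vec (A $ j)
      in (principal_ray (A $ i) \<bullet> d) * (principal_ray (A $ j) \<bullet> d) < 0 \<and>
         (\<forall>k. center_vec (A $ k) \<notin> span {center_vec (A $ i), center_vec (A $ j)} \<longrightarrow>
            principal_ray (A $ k) \<bullet> d = 0))"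

text \<open>Excludes the two configurations in which the joint image meets \<open>C_set\<close> in a point that
  comes neither from the chiral domain nor from a center: an undecided baseline, and, for
  collinear centers, a common baseline that misses the chiral domain (its image always lies in
  the joint image and in \<open>C_set\<close>, all cross products there being zero).\<close>

definition decided_baselines :: "(camera^'m) \<Rightarrow> bool" where
  "decided_baselines A \<longleftrightarrow>
     (if collinear_centers A
      then \<exists>L. proj_line L \<and> centers A \<subseteq> L \<and> L \<inter> chiral_domain A \<noteq> {}
      else \<forall>i j. \<not> undecided_baseline A i j)"

end

theory Submission
  imports Defs
begin

text \<open>Write a scene point as \<open>q = (x, w)\<close> and let \<open>n\<^sub>i\<close> be the principal rays. Up to the sign of \<open>q\<close>,
  the chiral domain is cut out by \<open>w \<ge> 0\<close> and \<open>n\<^sub>i \<bullet> q \<ge> 0\<close> for all \<open>i\<close> (lemma \<open>chiral_domain_eq\<close>).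
  So the inequalities of \<open>C_set\<close> have to force the numbers \<open>w\<close>, \<open>n\<^sub>1 \<bullet> q\<close>, \<open>\<dots>\<close>, \<open>n\<^sub>m \<bullet> q\<close> to have
  a common sign.

  Closures are controlled by incidence: \<open>p\<close> is incident with \<open>q\<close> if each camera whose center is
  not \<open>q\<close> maps \<open>q\<close> to its component of \<open>p\<close>. Incidence with a point of a closed cone is a closed
  condition by compactness of the sphere (\<open>closed_incidence\<close>), and it adds to the joint image
  the sets \<open>E_set A j\<close> of the centers in the cone (\<open>incidence_eq\<close>). For the cone of all vectors this is
  the closure of the joint image; for the visible cone it is the chiral joint image together with
  \<open>E_plus A\<close>. The latter exceeds the closure of the chiral joint image only within \<open>E_zero A\<close>,
  because near a center that has positive depth in all other cameras every direction of approach
  or its opposite is visible (\<open>closure_chiral_joint_image\<close>).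

  If \<open>p\<close> is incident with \<open>q\<close>, the two inequalities for cameras \<open>i\<close> and \<open>j\<close> become, up to a common
  positive factor, \<open>(n\<^sub>i \<bullet> q) w \<ge> 0\<close> and \<open>(n\<^sub>i \<bullet> q) (n\<^sub>j \<bullet> q) \<ge> 0\<close>, both multiplied by the squared
  norm of the cross product of the baseline with the ray of \<open>p\<close> in camera \<open>j\<close>
  (\<open>C_set_terms\<close>). Visible points therefore satisfy them, and a failure of the converse
  requires that some of these cross products vanish. If \<open>q\<close> is finite and behind camera \<open>i\<close>, all
  products involving \<open>i\<close> vanish, so that all centers are collinear (\<open>C_set_finite_exception\<close>). If \<open>q\<close>
  is ideal and cameras \<open>k\<close> and \<open>l\<close> disagree on its sign, then \<open>q\<close> is the direction of their baseline
  and every camera off this baseline has depth sign 0, so that the baseline is undecided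
  (\<open>C_set_ideal_exception\<close>). In either case, if the centers are collinear, then \<open>p\<close> is the image of
  the line that contains them (\<open>common_baseline\<close>), and this point always satisfies the inequalities.\<close>

section \<open>Scene points seen from a camera\<close>

definition xyz :: "real^4 \<Rightarrow> real^3" where
  "xyz q = vector [q $ 1, q $ 2, q $ 3]"

definition center_pos :: "camera \<Rightarrow> real^3" where
  "center_pos A = - (matrix_inv (left_block A) *v last_col A)"

text \<open>The view of \<open>q\<close> is \<open>G\<^sup>-\<^sup>1 (A q)\<close>, the back-projection of the image of \<open>q\<close> to a direction in
  space. For a finite point it is, up to scale, the vector from the center of the camera to the
  point, and for an ideal point it is the same vector for all cameras.\<close>

definition view :: "camera \<Rightarrow> real^4 \<Rightarrow> real^3" where
  "view A q = xyz q - q $ 4 *\<^sub>R center_pos A"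

definition ray :: "camera \<Rightarrow> 3 proj \<Rightarrow> real^3" where
  "ray A p = matrix_inv (left_block A) *v rep p"

lemma vec4_eq_iff: "(u::real^4) = v \<longleftrightarrow> xyz u = xyz v \<and> u $ 4 = v $ 4"
  by (auto simp: vec_eq_iff forall_4 forall_3 xyz_def)

lemma xyz_linear [simp]:
  "xyz (u + v) = xyz u + xyz v" "xyz (u - v) = xyz u - xyz v" "xyz (- u) = - xyz u"
  "xyz (k *\<^sub>R u) = k *\<^sub>R xyz u" "xyz 0 = 0"
  by (simp_all add: vec_eq_iff forall_3 xyz_def)

lemma vector_4 [simp]:
  "(vector [w, x, y, z] :: 'a::zero^4) $ 1 = w" "(vector [w, x, y, z] :: 'a::zero^4) $ 2 = x"
  "(vector [w, x, y, z] :: 'a::zero^4) $ 3 = y" "(vector [w, x, y, z] :: 'a::zero^4) $ 4 = z"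
  by (simp_all add: vector_def)

lemma center_vec_coords [simp]: "xyz (center_vec A) = center_pos A" "center_vec A $ 4 = 1"
  by (simp_all add: vec_eq_iff forall_3 xyz_def center_vec_def center_pos_def Let_def)

lemma center_vec_nonzero [simp]: "center_vec A \<noteq> 0"
  by (metis center_vec_coords(2) zero_index zero_neq_one)

lemma view_linear:
  "view A (u + v) = view A u + view A v" "view A (u - v) = view A u - view A v"
  "view A (k *\<^sub>R u) = k *\<^sub>R view A u"
  by (simp_all add: view_def algebra_simps)

lemma view_center: "view A (center_vec B) = center_pos B - center_pos A"
  by (simp add: view_def)

lemma finite_camera_inverse:
  assumes "finite_camera A"
  shows "left_block A *v (matrix_inv (left_block A) *v x) = x"
    and "matrix_inv (left_block A) *v (left_block A *v x) = x"
proof -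
  have "invertible (left_block A)"
    using assms by (simp add: finite_camera_def invertible_det_nz)
  then have "left_block A ** matrix_inv (left_block A) = mat 1"
    and "matrix_inv (left_block A) ** left_block A = mat 1"
    unfolding invertible_def matrix_inv_def by (rule someI2_ex; blast)+
  then show "left_block A *v (matrix_inv (left_block A) *v x) = x"
    and "matrix_inv (left_block A) *v (left_block A *v x) = x"
    by (simp_all add: matrix_vector_mul_assoc)
qed

lemma camera_mult:
  assumes "finite_camera A"
  shows "A *v q = left_block A *v view A q"
proof -
  have "left_block A *v view A q
      = left_block A *v xyz q + q $ 4 *\<^sub>R (left_block A *v (matrix_inv (left_block A) *v last_col A))"
    by (simp add: view_def center_pos_def matrix_vector_mult_diff_distrib
        matrix_vector_mult_scaleR matrix_vector_right_distrib)
  also have "\<dots> = left_block A *v xyz q + q $ 4 *\<^sub>R last_col A"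
    by (simp add: finite_camera_inverse[OF assms])
  also have "\<dots> = A *v q"
    by (simp add: vec_eq_iff matrix_vector_mult_def sum_3 sum_4 left_block_def last_col_def xyz_def
        forall_3 algebra_simps)
  finally show ?thesis ..
qed

lemma camera_eq_0_iff:
  assumes "finite_camera A"
  shows "A *v q = 0 \<longleftrightarrow> view A q = 0"
  by (metis assms camera_mult finite_camera_inverse(2) matrix_vector_mult_0_right)

lemma view_eq_0_iff: "view A q = 0 \<longleftrightarrow> q = q $ 4 *\<^sub>R center_vec A"
  by (auto simp: vec4_eq_iff view_def)

lemma ray_pt:
  assumes "finite_camera A" "A *v q \<noteq> 0"
  shows "\<exists>k. k \<noteq> 0 \<and> ray A (pt (A *v q)) = k *\<^sub>R view A q \<and> rep (pt (A *v q)) = k *\<^sub>R (A *v q)"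
  using rep_pt[OF assms(2)]
  by (metis assms(1) camera_mult finite_camera_inverse(2) matrix_vector_mult_scaleR ray_def)

lemma ray_nonzero:
  assumes "finite_camera A"
  shows "ray A p \<noteq> 0"
  by (metis assms finite_camera_inverse(1) matrix_vector_mult_0_right ray_def rep_nonzero)

lemma principal_ray_inner: "principal_ray A \<bullet> q = det (left_block A) * (A *v q) $ 3"
  by (simp add: principal_ray_def matrix_vector_mult_def inner_vec_def sum_distrib_left mult.assoc)

lemma cross3_eq_0_multiple:
  assumes "cross3 u v = 0" "u \<noteq> 0"
  obtains k where "v = k *\<^sub>R u"
  using assms by (metis cross_eq_0 collinear_lemma scaleR_zero_left)

lemma pt_scaleR: "k \<noteq> 0 \<Longrightarrow> pt (k *\<^sub>R v) = pt v"
  by (cases "v = 0") (auto simp: pt_eq_iff)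

lemma cam_image_pt: "q \<noteq> 0 \<Longrightarrow> cam_image A (pt q) = pt (A *v q)"
  unfolding cam_image_def using rep_pt[of q] by (auto simp: matrix_vector_mult_scaleR pt_scaleR)

lemma pt_eq_center_iff:
  assumes "q \<noteq> 0"
  shows "pt q = center A \<longleftrightarrow> view A q = 0"
  unfolding center_def pt_eq_iff[OF assms center_vec_nonzero] view_eq_0_iff
proof
  assume "\<exists>k. k \<noteq> 0 \<and> q = k *\<^sub>R center_vec A"
  then show "q = q $ 4 *\<^sub>R center_vec A" by auto
next
  assume "q = q $ 4 *\<^sub>R center_vec A"
  with assms show "\<exists>k. k \<noteq> 0 \<and> q = k *\<^sub>R center_vec A" by (metis scaleR_zero_left)
qed

section \<open>Topology of projective spaces\<close>

lemma tendsto_pt: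
  fixes f :: "'a \<Rightarrow> real^'n"
  assumes "(f \<longlongrightarrow> v) F" "v \<noteq> 0"
  shows "((\<lambda>x. pt (f x)) \<longlongrightarrow> pt v) F"
proof (rule topological_tendstoI)
  fix U :: "'n proj set"
  assume "open U" "pt v \<in> U"
  then have "\<forall>\<^sub>F x in F. f x \<in> {v. v \<noteq> 0 \<and> pt v \<in> U}"
    using assms by (intro topological_tendstoD[OF assms(1)]) (auto simp: open_proj_def)
  then show "\<forall>\<^sub>F x in F. pt (f x) \<in> U" by (rule eventually_mono) auto
qed

lemma open_pt_image:
  fixes U :: "(real^'n) set"
  assumes "open U"
  shows "open (pt ` (U - {0}))"
proof -
  have "{v. v \<noteq> 0 \<and> pt v \<in> pt ` (U - {0})} = (\<Union>k\<in>-{0}. (\<lambda>x. k *\<^sub>R x) ` (U - {0}))"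
    (is "?L = ?R")
  proof
    show "?L \<subseteq> ?R"
    proof
      fix v assume "v \<in> ?L"
      then obtain u where "v \<noteq> 0" "u \<in> U - {0}" "pt v = pt u" by auto
      then obtain k where "k \<noteq> 0" "v = k *\<^sub>R u" using pt_eq_iff[of v u] by auto
      with \<open>u \<in> U - {0}\<close> show "v \<in> ?R" by blast
    qed
    show "?R \<subseteq> ?L" by (auto simp: pt_scaleR)
  qed
  moreover have "open \<dots>"
    using assms by (intro open_UN ballI open_scaling) auto
  ultimately show ?thesis by (simp add: open_proj_def)
qed

text \<open>The map that sends a tuple of nonzero vectors to a tuple of projective points is open, so
  closedness may be tested on homogeneous coordinates, in a Euclidean space. The set \<open>T\<close> need
  only be right on tuples without zero components.\<close>

lemma closed_multi_proj:
  fixes S :: "(('n::finite proj)^'m) set"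
  assumes "closed T"
    and lift: "\<And>v. (\<And>i. v $ i \<noteq> 0) \<Longrightarrow> (\<chi> i. pt (v $ i)) \<in> S \<longleftrightarrow> v \<in> T"
  shows "closed S"
  unfolding closed_def open_vec_def
proof
  fix p assume "p \<in> - S"
  then have lift_in: "(\<chi> i. rep (p $ i)) \<in> - T"
    using lift[of "\<chi> i. rep (p $ i)"] by simp
  have "open (- T)" using \<open>closed T\<close> by (simp add: open_Compl)
  then have "\<exists>U. (\<forall>i. open (U i) \<and> (\<chi> i. rep (p $ i)) $ i \<in> U i)
      \<and> (\<forall>v. (\<forall>i. v $ i \<in> U i) \<longrightarrow> v \<in> - T)"
    using lift_in unfolding open_vec_def[of "- T"] by (rule bspec)
  then obtain U where U_all: "\<forall>i. open (U i) \<and> (\<chi> i. rep (p $ i)) $ i \<in> U i"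
    and U_sub: "\<forall>v. (\<forall>i. v $ i \<in> U i) \<longrightarrow> v \<in> - T"
    by blast
  have U: "open (U i)" "rep (p $ i) \<in> U i" for i using U_all by simp_all
  have sub: "v \<in> - T" if "\<And>i. v $ i \<in> U i" for v using U_sub that by blast
  have "p $ i \<in> pt ` (U i - {0})" for i
    using U(2)[of i] by (intro image_eqI[of _ _ "rep (p $ i)"]) auto
  then have "\<forall>i. open (pt ` (U i - {0})) \<and> p $ i \<in> pt ` (U i - {0})"
    using U(1) open_pt_image by blast
  moreover have "p' \<in> - S" if p': "\<forall>i. p' $ i \<in> pt ` (U i - {0})" for p'
  proof -
    have "\<forall>i. \<exists>u. u \<in> U i \<and> u \<noteq> 0 \<and> p' $ i = pt u" using p' by blast
    then obtain u where u: "\<And>i. u i \<in> U i" "\<And>i. u i \<noteq> 0" "\<And>i. p' $ i = pt (u i)"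
      by metis
    have "(\<chi> i. u i) \<in> - T" using u by (intro sub) simp
    moreover have "p' = (\<chi> i. pt ((\<chi> i. u i) $ i))" using u by (simp add: vec_eq_iff)
    ultimately show ?thesis using lift[of "\<chi> i. u i"] u by simp
  qed
  ultimately show "\<exists>V. (\<forall>i. open (V i) \<and> p $ i \<in> V i) \<and> (\<forall>y. (\<forall>i. y $ i \<in> V i) \<longrightarrow> y \<in> - S)"
    by (intro exI[of _ "\<lambda>i. pt ` (U i - {0})"]) blast
qed

section \<open>The chiral domain is the projectivization of a cone\<close>

definition visible_cone :: "(camera^'m) \<Rightarrow> (real^4) set" where
  "visible_cone A = {q. q $ 4 \<ge> 0 \<and> (\<forall>i. principal_ray (A $ i) \<bullet> q \<ge> 0)}"

lemma n_inf_inner: "n_inf \<bullet> q = q $ 4"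
  by (simp add: n_inf_def inner_vec_def sum_4)

lemma depth_pt:
  assumes "q \<noteq> 0"
  shows "depth (pt q) A
    = 1 / (\<bar>det (left_block A)\<bar> * norm (left_block A $ 3)) * ((principal_ray A \<bullet> q) / q $ 4)"
  using rep_pt[OF assms] by (auto simp: depth_def n_inf_inner)

lemma depth_factor_pos:
  assumes "finite_camera A"
  shows "1 / (\<bar>det (left_block A)\<bar> * norm (left_block A $ 3)) > 0"
proof -
  have "left_block A $ 3 \<noteq> 0"
    using assms det_zero_row(1)[of 3 "left_block A"] by (auto simp: finite_camera_def row_def vec_eq_iff)
  then show ?thesis using assms by (simp add: finite_camera_def)
qed

lemma visible_cone_scaleR: "q \<in> visible_cone A \<Longrightarrow> k > 0 \<Longrightarrow> k *\<^sub>R q \<in> visible_cone A"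
  by (auto simp: visible_cone_def)

lemma closed_visible_cone: "closed (visible_cone A)"
  unfolding visible_cone_def
  by (intro closed_Collect_conj closed_Collect_all closed_Collect_le continuous_intros)

text \<open>The cone of the weak inequalities is closed, hence so is its image. Conversely a point of the
  cone is the limit of the points reached from it by a small step towards a point of positive
  depth; this is where the chiral domain must be nonempty, for otherwise the cone can still
  contain points on its boundary.\<close>

lemma chiral_domain_eq:
  fixes A :: "camera^'m"
  assumes fin: "\<forall>i. finite_camera (A $ i)" and "chiral_domain A \<noteq> {}"
  shows "chiral_domain A = pt ` (visible_cone A - {0})"
proof -
  let ?P = "{q. finite_point q \<and> (\<forall>i. depth q (A $ i) > 0)}"
  have depth_sign: "depth (pt q) (A $ i) > 0 \<longleftrightarrow> (principal_ray (A $ i) \<bullet> q) / q $ 4 > 0"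
    if "q \<noteq> 0" for q i
    using depth_factor_pos[of "A $ i"] fin
    unfolding depth_pt[OF that] by (metis mult_less_cancel_left_pos mult_zero_right)
  have lift: "\<exists>q. z = pt q \<and> q $ 4 > 0 \<and> (\<forall>i. principal_ray (A $ i) \<bullet> q > 0)" if "z \<in> ?P" for z
  proof (cases "rep z $ 4 > 0")
    case True
    then show ?thesis using that depth_sign[of "rep z"]
      by (auto intro!: exI[of _ "rep z"] simp: zero_less_divide_iff)
  next
    case False
    then have "rep z $ 4 < 0" using that by (simp add: finite_point_def)
    moreover have "z = pt (- rep z)" using pt_scaleR[of "-1" "rep z"] by simp
    ultimately show ?thesis using that depth_sign[of "rep z"]
      by (intro exI[of _ "- rep z"]) (auto simp: zero_less_divide_iff)
  qed
  have "closed (pt ` (visible_cone A - {0}))"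
  proof -
    have cone_iff: "pt v \<in> pt ` (visible_cone A - {0}) \<longleftrightarrow> v \<in> visible_cone A \<or> - v \<in> visible_cone A"
      if v: "v \<noteq> 0" for v
    proof
      assume "pt v \<in> pt ` (visible_cone A - {0})"
      then obtain q where q: "q \<noteq> 0" "pt v = pt q" "q \<in> visible_cone A" by auto
      then obtain k where "k \<noteq> 0" "v = k *\<^sub>R q" using v pt_eq_iff[of v q] by auto
      then show "v \<in> visible_cone A \<or> - v \<in> visible_cone A"
        using visible_cone_scaleR[of q A k] visible_cone_scaleR[of q A "-k"] q(3)
        by (cases "k > 0") auto
    next
      assume "v \<in> visible_cone A \<or> - v \<in> visible_cone A"
      moreover have "pt v = pt (- v)" using pt_scaleR[of "-1" v] by simp
      ultimately show "pt v \<in> pt ` (visible_cone A - {0})"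
        using v by (metis Diff_iff imageI neg_equal_0_iff_equal singletonD)
    qed
    then have "{v. v \<noteq> 0 \<and> pt v \<in> - pt ` (visible_cone A - {0})}
        = - {0} \<inter> - visible_cone A \<inter> - uminus ` visible_cone A"
      (is "?L = ?R")
    proof (intro set_eqI)
      fix v
      have "v \<in> uminus ` visible_cone A \<longleftrightarrow> - v \<in> visible_cone A"
        by (metis image_eqI imageE minus_minus)
      then show "v \<in> ?L \<longleftrightarrow> v \<in> ?R" using cone_iff[of v] by auto
    qed
    moreover have "open \<dots>"
      using closed_visible_cone[of A] closed_negations[OF closed_visible_cone[of A]]
      by (intro open_Int open_Compl) auto
    ultimately show ?thesis by (simp add: closed_def open_proj_def)
  qed
  moreover have "?P \<subseteq> pt ` (visible_cone A - {0})"
  proof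
    fix z assume "z \<in> ?P"
    from lift[OF this] obtain q where "z = pt q" "q $ 4 > 0" "\<forall>i. principal_ray (A $ i) \<bullet> q > 0" by auto
    then show "z \<in> pt ` (visible_cone A - {0})"
      by (intro image_eqI[of _ _ q]) (auto simp: visible_cone_def less_imp_le)
  qed
  ultimately have "chiral_domain A \<subseteq> pt ` (visible_cone A - {0})"
    unfolding chiral_domain_def by (rule closure_minimal[rotated])
  moreover have "pt q \<in> chiral_domain A" if q: "q \<in> visible_cone A" "q \<noteq> 0" for q
  proof -
    obtain z where "z \<in> ?P" using assms(2) unfolding chiral_domain_def by fastforce
    from lift[OF this] obtain q0 where q0: "q0 $ 4 > 0" "\<forall>i. principal_ray (A $ i) \<bullet> q0 > 0" by auto
    have lim: "((\<lambda>e. pt (q + e *\<^sub>R q0)) \<longlongrightarrow> pt q) (at_right 0)"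
      by (rule tendsto_pt[OF _ q(2)]) (auto intro!: tendsto_eq_intros)
    have "\<forall>\<^sub>F e in at_right 0. pt (q + e *\<^sub>R q0) \<in> chiral_domain A"
      using eventually_at_right_less[of 0]
    proof eventually_elim
      case (elim e)
      let ?q = "q + e *\<^sub>R q0"
      have pos: "?q $ 4 > 0" "\<forall>i. principal_ray (A $ i) \<bullet> ?q > 0"
        using q(1) q0 elim by (auto simp: visible_cone_def inner_add_right intro!: add_nonneg_pos)
      then have "?q \<noteq> 0" by auto
      obtain k where "k \<noteq> 0" "rep (pt ?q) = k *\<^sub>R ?q" using rep_pt[OF \<open>?q \<noteq> 0\<close>] by blast
      then have "finite_point (pt ?q)"
        using pos(1) by (simp add: finite_point_def)
      moreover have "depth (pt ?q) (A $ i) > 0" for i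
        unfolding depth_sign[OF \<open>?q \<noteq> 0\<close>] by (rule divide_pos_pos[OF pos(2)[rule_format] pos(1)])
      ultimately have "pt ?q \<in> ?P" by blast
      then show ?case unfolding chiral_domain_def by (rule subsetD[OF closure_subset])
    qed
    then show ?thesis
      using Lim_in_closed_set[OF _ _ trivial_limit_at_right_real lim, of "chiral_domain A"]
      by (simp add: chiral_domain_def)
  qed
  ultimately show ?thesis by auto
qed

lemma depth_center_eq_0_iff:
  assumes "finite_camera A"
  shows "depth (center B) A = 0 \<longleftrightarrow> principal_ray A \<bullet> center_vec B = 0"
  using depth_factor_pos[OF assms]
  unfolding center_def depth_pt[OF center_vec_nonzero] center_vec_coords(2) div_by_1
  by (metis less_irrefl mult_eq_0_iff)

lemma center_in_chiral_domain_iff: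
  fixes A :: "camera^'m"
  assumes fin: "\<forall>i. finite_camera (A $ i)" and ne: "chiral_domain A \<noteq> {}"
  shows "center B \<in> chiral_domain A \<longleftrightarrow> center_vec B \<in> visible_cone A"
proof
  assume "center B \<in> chiral_domain A"
  then obtain q where q: "q \<in> visible_cone A" "q \<noteq> 0" "center B = pt q"
    unfolding chiral_domain_eq[OF assms] by auto
  then obtain k where k: "k \<noteq> 0" "q = k *\<^sub>R center_vec B"
    unfolding center_def using pt_eq_iff[of q "center_vec B"] by auto
  with q have "k > 0" by (auto simp: visible_cone_def)
  then show "center_vec B \<in> visible_cone A"
    using visible_cone_scaleR[OF q(1), of "inverse k"] k by simp
next
  assume "center_vec B \<in> visible_cone A"
  then show "center B \<in> chiral_domain A"
    unfolding chiral_domain_eq[OF assms] center_def by simp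
qed

section \<open>Closures of joint images\<close>

text \<open>For a closed cone of scene points, incidence replaces a center by its blow-up: the camera that
  does not see the point may report any image. Allowing zero in place of an image is
  what makes this an algebraic, hence closed, condition on the pair of \<open>p\<close> and \<open>q\<close>.\<close>

definition incidence :: "(camera^'m) \<Rightarrow> (real^4) set \<Rightarrow> ((3 proj)^'m) set" where
  "incidence A F =
    {p. \<exists>q\<in>F - {0}. \<forall>i. A $ i *v q \<noteq> 0 \<longrightarrow> p $ i = pt (A $ i *v q)}"

text \<open>Scaling \<open>q\<close> to the unit sphere makes the set of admissible \<open>q\<close> compact, and the projection of a
  closed set along a compact factor is closed. The condition is the vanishing of the cross
  products of image coordinates with \<open>A q\<close>.\<close>

lemma closed_incidence:
  fixes A :: "camera^'m"
  assumes "closed F" and cone: "\<And>q k. q \<in> F \<Longrightarrow> k > 0 \<Longrightarrow> k *\<^sub>R q \<in> F"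
  shows "closed (incidence A F)"
proof (rule closed_multi_proj)
  let ?R = "{z :: (real^4) \<times> (real^3^'m). \<forall>i. cross3 (A $ i *v fst z) (snd z $ i) = 0}"
  have "closed ?R"
    by (intro closed_Collect_all closed_Collect_eq continuous_on_cross continuous_intros
        matrix_vector_mult_linear_continuous_on[THEN continuous_on_compose2[where s=UNIV]]) auto
  moreover have "compact (F \<inter> sphere 0 1)"
    using \<open>closed F\<close> by (simp add: closed_Int_compact)
  ultimately show "closed {v. \<exists>x. x \<in> F \<inter> sphere 0 1 \<and> (x, v) \<in> ?R}"
    by (rule closed_compact_projection[rotated])
  fix v :: "real^3^'m"
  assume v: "\<And>i. v $ i \<noteq> 0"
  show "(\<chi> i. pt (v $ i)) \<in> incidence A F \<longleftrightarrow> v \<in> {v. \<exists>x. x \<in> F \<inter> sphere 0 1 \<and> (x, v) \<in> ?R}"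
  proof
    assume "(\<chi> i. pt (v $ i)) \<in> incidence A F"
    then obtain q where q: "q \<in> F" "q \<noteq> 0" "\<And>i. A $ i *v q \<noteq> 0 \<Longrightarrow> pt (v $ i) = pt (A $ i *v q)"
      unfolding incidence_def by auto
    let ?x = "inverse (norm q) *\<^sub>R q"
    have "cross3 (A $ i *v ?x) (v $ i) = 0" for i
    proof (cases "A $ i *v q = 0")
      case False
      then obtain k where "v $ i = k *\<^sub>R (A $ i *v q)" using q(3) v pt_eq_iff by metis
      then show ?thesis by (simp add: matrix_vector_mult_scaleR cross_mult_left cross_mult_right)
    qed (simp add: matrix_vector_mult_scaleR)
    then show "v \<in> {v. \<exists>x. x \<in> F \<inter> sphere 0 1 \<and> (x, v) \<in> ?R}"
      using q cone by (auto intro!: exI[of _ ?x])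
  next
    assume "v \<in> {v. \<exists>x. x \<in> F \<inter> sphere 0 1 \<and> (x, v) \<in> ?R}"
    then obtain x where x: "x \<in> F" "norm x = 1" "\<And>i. cross3 (A $ i *v x) (v $ i) = 0" by auto
    have "pt (v $ i) = pt (A $ i *v x)" if nz: "A $ i *v x \<noteq> 0" for i
    proof -
      obtain k where "v $ i = k *\<^sub>R (A $ i *v x)" using cross3_eq_0_multiple[OF x(3) nz] by blast
      moreover from this have "k \<noteq> 0" using v[of i] by auto
      ultimately show ?thesis by (simp add: pt_scaleR)
    qed
    then show "(\<chi> i. pt (v $ i)) \<in> incidence A F"
      using x unfolding incidence_def by (auto intro!: bexI[of _ x])
  qed
qed

lemma incidence_eq:
  fixes A :: "camera^'m"
  assumes fin: "\<forall>i. finite_camera (A $ i)" and inj: "inj (\<lambda>i. center (A $ i))"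
  shows "incidence A F = phi A ` (pt ` (F - {0}) - centers A)
    \<union> \<Union> {E_set A j | j. center (A $ j) \<in> pt ` (F - {0})}"
proof (intro equalityI subsetI)
  fix p assume "p \<in> incidence A F"
  then obtain q where q: "q \<in> F - {0}" "\<And>i. A $ i *v q \<noteq> 0 \<Longrightarrow> p $ i = pt (A $ i *v q)"
    unfolding incidence_def by auto
  have sees: "A $ i *v q \<noteq> 0 \<longleftrightarrow> pt q \<noteq> center (A $ i)" for i
    using q(1) fin by (simp add: pt_eq_center_iff camera_eq_0_iff)
  show "p \<in> phi A ` (pt ` (F - {0}) - centers A)
      \<union> \<Union> {E_set A j | j. center (A $ j) \<in> pt ` (F - {0})}"
  proof (cases "pt q \<in> centers A")
    case True
    then obtain j where j: "pt q = center (A $ j)" by (auto simp: centers_def)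
    have "p $ i = epipole A i j" if "i \<noteq> j" for i
      using that j inj q sees[of i] cam_image_pt[of q "A $ i"]
      by (auto simp: epipole_def dest: injD)
    then have "p \<in> E_set A j" by (simp add: E_set_def)
    moreover have "center (A $ j) \<in> pt ` (F - {0})" using j q(1) by (metis imageI)
    ultimately show ?thesis by blast
  next
    case False
    then have "p $ i = pt (A $ i *v q)" for i using q(2) sees[of i] by (auto simp: centers_def)
    then have "p = phi A (pt q)" using q(1) by (simp add: vec_eq_iff phi_def cam_image_pt)
    with False q(1) show ?thesis by blast
  qed
next
  fix p assume "p \<in> phi A ` (pt ` (F - {0}) - centers A)
      \<union> \<Union> {E_set A j | j. center (A $ j) \<in> pt ` (F - {0})}"
  then consider (image) q where "q \<in> F - {0}" "p = phi A (pt q)"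
    | (center) j where "center (A $ j) \<in> pt ` (F - {0})" "p \<in> E_set A j" by blast
  then show "p \<in> incidence A F"
  proof cases
    case image
    then show ?thesis unfolding incidence_def by (auto simp: phi_def cam_image_pt intro!: bexI[of _ q])
  next
    case center
    then obtain q where q: "q \<in> F - {0}" "center (A $ j) = pt q" by blast
    have "p $ i = pt (A $ i *v q)" if "A $ i *v q \<noteq> 0" for i
    proof -
      have "i \<noteq> j" using that q fin pt_eq_center_iff[of q "A $ j"] by (auto simp: camera_eq_0_iff)
      then show ?thesis using center q by (simp add: E_set_def epipole_def cam_image_pt)
    qed
    with q show ?thesis unfolding incidence_def by blast
  qed
qed

text \<open>A point of \<open>E_set A j\<close> is approached by moving away from the center of camera \<open>j\<close> in the
  direction \<open>u\<close> that camera \<open>j\<close> sees as the prescribed point: its image stays constant while the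
  images in the other cameras converge to the epipoles.\<close>

lemma E_set_in_closure:
  fixes A :: "camera^'m"
  assumes fin: "\<forall>i. finite_camera (A $ i)" and inj: "inj (\<lambda>i. center (A $ i))"
    and p: "p \<in> E_set A j"
    and u: "u $ 4 = 0" "A $ j *v u = k *\<^sub>R rep (p $ j)" "k \<noteq> 0"
    and F: "\<forall>\<^sub>F e in at_right 0. center_vec (A $ j) + e *\<^sub>R u \<in> F"
  shows "p \<in> closure (phi A ` (pt ` (F - {0}) - centers A))"
proof -
  define c where "c = center_vec (A $ j)"
  have [simp]: "c \<noteq> 0" by (simp add: c_def)
  have ptc: "pt c = center (A $ j)" by (simp add: c_def center_def)
  have Ac: "A $ i *v c \<noteq> 0" if "i \<noteq> j" for i
    using that inj fin pt_eq_center_iff[of c "A $ i"] ptc by (auto simp: camera_eq_0_iff dest: injD)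
  have Aj: "A $ j *v (c + e *\<^sub>R u) = (e * k) *\<^sub>R rep (p $ j)" for e
  proof -
    have "A $ j *v c = 0" using fin by (simp add: camera_eq_0_iff view_center c_def)
    then show ?thesis using u by (simp add: matrix_vector_right_distrib matrix_vector_mult_scaleR)
  qed
  have lim: "((\<lambda>e. A $ i *v (c + e *\<^sub>R u)) \<longlongrightarrow> A $ i *v c) (at_right 0)" for i
    unfolding matrix_vector_right_distrib matrix_vector_mult_scaleR
    by (auto intro!: tendsto_eq_intros)
  have pos: "\<forall>\<^sub>F e in at_right (0::real). e > 0" by (rule eventually_at_right_less)
  have nz: "c + e *\<^sub>R u \<noteq> 0" for e
    using u(1) by (auto simp: c_def vec4_eq_iff)
  have lim_p: "((\<lambda>e. phi A (pt (c + e *\<^sub>R u))) \<longlongrightarrow> p) (at_right 0)"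
  proof (rule vec_tendstoI)
    fix i
    show "((\<lambda>e. phi A (pt (c + e *\<^sub>R u)) $ i) \<longlongrightarrow> p $ i) (at_right 0)"
    proof (cases "i = j")
      case True
      have "\<forall>\<^sub>F e in at_right 0. phi A (pt (c + e *\<^sub>R u)) $ i = p $ i"
        using pos by eventually_elim (use u(3) in \<open>simp add: True phi_def cam_image_pt nz Aj pt_scaleR\<close>)
      then show ?thesis by (rule tendsto_eventually)
    next
      case False
      have "p $ i = pt (A $ i *v c)"
        using p False ptc cam_image_pt[of c "A $ i"] by (simp add: E_set_def epipole_def)
      then show ?thesis
        using tendsto_pt[OF lim Ac[OF False]] by (simp add: phi_def cam_image_pt nz)
    qed
  qed
  have "\<forall>\<^sub>F e in at_right 0. \<forall>i. A $ i *v (c + e *\<^sub>R u) \<noteq> 0"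
  proof (rule eventually_all_finite)
    fix i
    show "\<forall>\<^sub>F e in at_right 0. A $ i *v (c + e *\<^sub>R u) \<noteq> 0"
    proof (cases "i = j")
      case True
      show ?thesis using pos by eventually_elim (use u(3) in \<open>simp add: True Aj\<close>)
    next
      case False
      show ?thesis by (rule tendsto_imp_eventually_ne[OF lim Ac[OF False]])
    qed
  qed
  then have "\<forall>\<^sub>F e in at_right 0.
      phi A (pt (c + e *\<^sub>R u)) \<in> closure (phi A ` (pt ` (F - {0}) - centers A))"
    using F[folded c_def]
  proof eventually_elim
    case (elim e)
    then have "pt (c + e *\<^sub>R u) \<notin> centers A"
      using fin pt_eq_center_iff[OF nz[of e]] by (auto simp: centers_def camera_eq_0_iff)
    with elim nz have "phi A (pt (c + e *\<^sub>R u)) \<in> phi A ` (pt ` (F - {0}) - centers A)" by blast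
    then show ?case by (rule subsetD[OF closure_subset])
  qed
  then show ?thesis
    by (rule Lim_in_closed_set[OF closed_closure _ trivial_limit_at_right_real lim_p])
qed

lemma ideal_point_on_ray:
  assumes "finite_camera A"
  obtains u where "u $ 4 = 0" "A *v u = rep p"
proof -
  define v where "v = ray A p"
  define u :: "real^4" where "u = vector [v $ 1, v $ 2, v $ 3, 0]"
  have "xyz u = v" "u $ 4 = 0" by (simp_all add: u_def xyz_def vec_eq_iff forall_3)
  then have "A *v u = rep p"
    using assms by (simp add: camera_mult view_def v_def ray_def finite_camera_inverse)
  with \<open>u $ 4 = 0\<close> show ?thesis using that by blast
qed

lemma range_pt: "pt ` (UNIV - {0}) = UNIV"
proof -
  have "q \<in> pt ` (UNIV - {0})" for q :: "'n::finite proj"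
    by (rule image_eqI[of _ _ "rep q"]) auto
  then show ?thesis by blast
qed

lemma closure_joint_image:
  fixes A :: "camera^'m"
  assumes fin: "\<forall>i. finite_camera (A $ i)" and inj: "inj (\<lambda>i. center (A $ i))"
  shows "closure (joint_image A) = incidence A UNIV"
proof
  have eq: "incidence A UNIV = joint_image A \<union> \<Union> {E_set A j | j. True}"
    unfolding incidence_eq[OF assms] joint_image_def range_pt by (simp add: Compl_eq_Diff_UNIV)
  have "closed (incidence A UNIV)" by (rule closed_incidence) auto
  then show "closure (joint_image A) \<subseteq> incidence A UNIV"
    by (rule closure_minimal[rotated]) (simp add: eq)
  have "p \<in> closure (joint_image A)" if "p \<in> E_set A j" for p j
  proof -
    obtain u where "u $ 4 = 0" "A $ j *v u = rep (p $ j)"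
      using ideal_point_on_ray fin by blast
    then show ?thesis
      using E_set_in_closure[OF fin inj that, of u 1 UNIV]
      by (simp add: joint_image_def Compl_eq_Diff_UNIV range_pt)
  qed
  then show "incidence A UNIV \<subseteq> closure (joint_image A)"
    unfolding eq by (intro Un_least closure_subset) blast
qed

lemma chiral_incidence:
  fixes A :: "camera^'m"
  assumes fin: "\<forall>i. finite_camera (A $ i)" and inj: "inj (\<lambda>i. center (A $ i))"
    and ne: "chiral_domain A \<noteq> {}"
  shows "incidence A (visible_cone A) = chiral_joint_image A \<union> E_plus A"
  unfolding incidence_eq[OF fin inj] chiral_joint_image_def E_plus_def chiral_domain_eq[OF fin ne] ..

text \<open>When all other cameras see center \<open>j\<close> with positive depth, a small step from it in any
  direction keeps those depths positive, and the sign of the step can be chosen so that the depth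
  in camera \<open>j\<close> is nonnegative too. Hence the whole set \<open>E_set A j\<close> consists of limits, and only
  the centers on a principal plane of another camera, collected in \<open>E_zero A\<close>, can fail.\<close>

lemma closure_chiral_joint_image:
  fixes A :: "camera^'m"
  assumes fin: "\<forall>i. finite_camera (A $ i)" and inj: "inj (\<lambda>i. center (A $ i))"
    and ne: "chiral_domain A \<noteq> {}"
  shows "closure (chiral_joint_image A) \<union> E_zero A = chiral_joint_image A \<union> E_plus A"
proof
  have "closed (incidence A (visible_cone A))"
    by (intro closed_incidence closed_visible_cone visible_cone_scaleR)
  then have "closure (chiral_joint_image A) \<subseteq> chiral_joint_image A \<union> E_plus A"
    unfolding chiral_incidence[OF assms] by (rule closure_minimal[rotated]) simp
  moreover have "E_zero A \<subseteq> E_plus A" unfolding E_zero_def E_plus_def by blast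
  ultimately show "closure (chiral_joint_image A) \<union> E_zero A \<subseteq> chiral_joint_image A \<union> E_plus A"
    by blast
  have "p \<in> closure (chiral_joint_image A) \<union> E_zero A"
    if p: "p \<in> E_set A j" and j: "center (A $ j) \<in> chiral_domain A" for p j
  proof (cases "\<exists>i. i \<noteq> j \<and> depth (center (A $ j)) (A $ i) = 0")
    case True
    with p j show ?thesis unfolding E_zero_def by blast
  next
    case False
    let ?c = "center_vec (A $ j)"
    have c_pos: "principal_ray (A $ i) \<bullet> ?c > 0" if "i \<noteq> j" for i
      using False that j fin center_in_chiral_domain_iff[OF fin ne, of "A $ j"]
      by (auto simp: depth_center_eq_0_iff visible_cone_def order.order_iff_strict)
    obtain u0 where u0: "u0 $ 4 = 0" "A $ j *v u0 = rep (p $ j)"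
      using ideal_point_on_ray fin by blast
    \<comment> \<open>Reversing the direction does not change the image point in camera \<open>j\<close>.\<close>
    define k :: real where "k = (if principal_ray (A $ j) \<bullet> u0 \<ge> 0 then 1 else -1)"
    define u where "u = k *\<^sub>R u0"
    have u: "u $ 4 = 0" "A $ j *v u = k *\<^sub>R rep (p $ j)" "k \<noteq> 0" "principal_ray (A $ j) \<bullet> u \<ge> 0"
      using u0 by (auto simp: u_def k_def matrix_vector_mult_scaleR)
    have cj: "principal_ray (A $ j) \<bullet> ?c = 0"
      using fin camera_eq_0_iff[of "A $ j" ?c] by (simp add: principal_ray_inner view_center)
    have "\<forall>\<^sub>F e in at_right 0. \<forall>i. principal_ray (A $ i) \<bullet> (?c + e *\<^sub>R u) \<ge> 0"
    proof (rule eventually_all_finite)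
      fix i
      show "\<forall>\<^sub>F e in at_right 0. principal_ray (A $ i) \<bullet> (?c + e *\<^sub>R u) \<ge> 0"
      proof (cases "i = j")
        case True
        show ?thesis using eventually_at_right_less[of 0]
          by eventually_elim (use True cj u(4) in \<open>simp add: inner_add_right\<close>)
      next
        case False
        have "((\<lambda>e. principal_ray (A $ i) \<bullet> (?c + e *\<^sub>R u)) \<longlongrightarrow> principal_ray (A $ i) \<bullet> ?c) (at_right 0)"
          by (auto intro!: tendsto_eq_intros)
        from order_tendstoD(1)[OF this c_pos[OF False]] show ?thesis
          by eventually_elim simp
      qed
    qed
    then have "\<forall>\<^sub>F e in at_right 0. ?c + e *\<^sub>R u \<in> visible_cone A"
      by eventually_elim (simp add: visible_cone_def u(1))
    from E_set_in_closure[OF fin inj p u(1-3) this] show ?thesis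
      by (simp add: chiral_joint_image_def chiral_domain_eq[OF fin ne])
  qed
  then have "E_plus A \<subseteq> closure (chiral_joint_image A) \<union> E_zero A"
    unfolding E_plus_def by blast
  then show "chiral_joint_image A \<union> E_plus A \<subseteq> closure (chiral_joint_image A) \<union> E_zero A"
    by (intro Un_least le_supI1[OF closure_subset])
qed

section \<open>The inequalities at the image of a scene point\<close>

definition baseline :: "camera \<Rightarrow> camera \<Rightarrow> real^3" where
  "baseline A B = center_pos B - center_pos A"

lemma view_baseline: "view A q = view B q + q $ 4 *\<^sub>R baseline A B"
  by (simp add: view_def baseline_def algebra_simps)

lemma center_vec_eq_iff: "center_vec A = center_vec B \<longleftrightarrow> center A = center B"
  using pt_eq_center_iff[of "center_vec A" B] view_eq_0_iff[of B "center_vec A"]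
  by (simp add: center_def)

lemma baseline_eq_0_iff: "baseline A B = 0 \<longleftrightarrow> center A = center B"
  by (auto simp: center_vec_eq_iff[symmetric] vec4_eq_iff baseline_def)

lemma baseline_nonzero:
  assumes "inj (\<lambda>i. center (A $ i))" "i \<noteq> j"
  shows "baseline (A $ i) (A $ j) \<noteq> 0"
  using assms by (auto simp: baseline_eq_0_iff dest: injD)

lemma C_set_rays:
  "p \<in> C_set A \<longleftrightarrow> (\<forall>i j. i \<noteq> j \<longrightarrow>
     (let b = baseline (A $ i) (A $ j); ai = ray (A $ i) (p $ i); aj = ray (A $ j) (p $ j) in
      det (left_block (A $ i)) * rep (p $ i) $ 3 * (cross3 ai aj \<bullet> cross3 b aj) \<ge> 0 \<and>
      det (left_block (A $ i)) * det (left_block (A $ j)) * rep (p $ i) $ 3 * rep (p $ j) $ 3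
        * (cross3 b ai \<bullet> cross3 b aj) \<ge> 0))"
  by (simp add: C_set_def Let_def ray_def baseline_def center_pos_def)

lemma incident_ray:
  assumes "finite_camera A" "view A q \<noteq> 0" "A *v q \<noteq> 0 \<Longrightarrow> p = pt (A *v q)"
  obtains k where "k \<noteq> 0" "ray A p = k *\<^sub>R view A q"
    "det (left_block A) * rep p $ 3 = k * (principal_ray A \<bullet> q)"
proof -
  have "A *v q \<noteq> 0" using assms by (simp add: camera_eq_0_iff)
  from ray_pt[OF assms(1) this] assms(3)[OF this] that show ?thesis
    by (force simp: principal_ray_inner)
qed

text \<open>The views of \<open>q\<close> from two cameras differ by a multiple of their baseline \<open>b\<close>. So, if \<open>q\<close> is
  neither center, all cross products in the inequalities are multiples of \<open>b \<times> v\<close>, and the squared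
  norm of \<open>b \<times> v\<close> can be factored out. The ray \<open>v\<close> stands on the right-hand sides,
  and not the view of \<open>q\<close>, so that the formulas hold also when \<open>q\<close> is the center of \<open>B\<close>, where \<open>v\<close> is
  arbitrary.\<close>

lemma C_set_terms:
  fixes A B :: camera and p p' :: "3 proj"
  defines "b \<equiv> baseline A B" and "u \<equiv> ray A p" and "v \<equiv> ray B p'"
  assumes fin: "finite_camera A" "finite_camera B" and "center A \<noteq> center B"
    and "q \<noteq> 0"
    and incA: "A *v q \<noteq> 0 \<Longrightarrow> p = pt (A *v q)" and incB: "B *v q \<noteq> 0 \<Longrightarrow> p' = pt (B *v q)"
  shows "\<exists>c>0. det (left_block A) * rep p $ 3 * (cross3 u v \<bullet> cross3 b v)
      = c * ((principal_ray A \<bullet> q) * q $ 4) * (cross3 b v \<bullet> cross3 b v) \<and>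
    det (left_block A) * det (left_block B) * rep p $ 3 * rep p' $ 3 * (cross3 b u \<bullet> cross3 b v)
      = c * ((principal_ray A \<bullet> q) * (principal_ray B \<bullet> q)) * (cross3 b v \<bullet> cross3 b v)"
proof -
  have zero: "principal_ray C \<bullet> q = 0" if "finite_camera C" "view C q = 0" for C
    using that camera_eq_0_iff[of C q] by (simp add: principal_ray_inner)
  have not_both: "view A q \<noteq> 0 \<or> view B q \<noteq> 0"
    using \<open>center A \<noteq> center B\<close> \<open>q \<noteq> 0\<close> pt_eq_center_iff by metis
  consider (A) "view A q = 0" "view B q \<noteq> 0" | (B) "view A q \<noteq> 0" "view B q = 0"
    | (none) "view A q \<noteq> 0" "view B q \<noteq> 0" using not_both by blast
  then show ?thesis
  proof cases
    case A
    obtain l where l: "v = l *\<^sub>R view B q"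
      using incident_ray[OF fin(2) A(2) incB] unfolding v_def by metis
    have "view B q = (- q $ 4) *\<^sub>R b"
      using A(1) view_baseline[of A q B] by (simp add: b_def add_eq_0_iff)
    then have "cross3 b v = 0" by (simp add: l cross_mult_right)
    then show ?thesis by (intro exI[of _ 1]) simp
  next
    case B
    obtain k where k: "k \<noteq> 0" "u = k *\<^sub>R view A q"
      "det (left_block A) * rep p $ 3 = k * (principal_ray A \<bullet> q)"
      using incident_ray[OF fin(1) B(1) incA] unfolding u_def by metis
    have u: "u = (k * q $ 4) *\<^sub>R b" using B(2) view_baseline[of A q B] by (simp add: b_def k(2))
    then have "cross3 b u = 0" by (simp add: cross_mult_right)
    moreover have "cross3 u v = (k * q $ 4) *\<^sub>R cross3 b v" by (simp add: u cross_mult_left)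
    moreover have "k * k > 0" using k(1) by (simp flip: power2_eq_square)
    ultimately show ?thesis using zero[OF fin(2) B(2)] by (intro exI[of _ "k * k"]) (simp add: k(3))
  next
    case none
    obtain k where k: "k \<noteq> 0" "u = k *\<^sub>R view A q"
      "det (left_block A) * rep p $ 3 = k * (principal_ray A \<bullet> q)"
      using incident_ray[OF fin(1) none(1) incA] unfolding u_def by metis
    obtain l where l: "l \<noteq> 0" "v = l *\<^sub>R view B q"
      "det (left_block B) * rep p' $ 3 = l * (principal_ray B \<bullet> q)"
      using incident_ray[OF fin(2) none(2) incB] unfolding v_def by metis
    define m where "m = cross3 b (view B q)"
    have m: "cross3 b v = l *\<^sub>R m" "cross3 b u = k *\<^sub>R m" "cross3 u v = (k * q $ 4 * l) *\<^sub>R m"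
      using view_baseline[of A q B]
      by (simp_all add: k(2) l(2) m_def b_def cross_mult_left cross_mult_right cross_add_left cross_add_right)
    have "det (left_block A) * rep p $ 3 * (cross3 u v \<bullet> cross3 b v)
        = k * (principal_ray A \<bullet> q) * (cross3 u v \<bullet> cross3 b v)"
      by (simp only: k(3))
    also have "\<dots> = k\<^sup>2 * ((principal_ray A \<bullet> q) * q $ 4) * (cross3 b v \<bullet> cross3 b v)"
      by (simp add: m power2_eq_square)
    finally have first: "det (left_block A) * rep p $ 3 * (cross3 u v \<bullet> cross3 b v)
        = k\<^sup>2 * ((principal_ray A \<bullet> q) * q $ 4) * (cross3 b v \<bullet> cross3 b v)" .
    have "det (left_block A) * det (left_block B) * rep p $ 3 * rep p' $ 3 * (cross3 b u \<bullet> cross3 b v)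
        = (det (left_block A) * rep p $ 3) * (det (left_block B) * rep p' $ 3) * (cross3 b u \<bullet> cross3 b v)"
      by (simp add: mult_ac)
    also have "\<dots> = k\<^sup>2 * ((principal_ray A \<bullet> q) * (principal_ray B \<bullet> q)) * (cross3 b v \<bullet> cross3 b v)"
      unfolding k(3) l(3) by (simp add: m power2_eq_square)
    finally show ?thesis using first k(1) by (intro exI[of _ "k\<^sup>2"]) simp
  qed
qed

text \<open>The inequalities of a pair of cameras thus compare signs, and are void when the second ray
  runs along the baseline.\<close>

lemma C_set_incident_iff:
  fixes A :: "camera^'m"
  assumes fin: "\<forall>i. finite_camera (A $ i)" and inj: "inj (\<lambda>i. center (A $ i))"
    and "q \<noteq> 0" and inc: "\<And>i. A $ i *v q \<noteq> 0 \<Longrightarrow> p $ i = pt (A $ i *v q)"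
  shows "p \<in> C_set A \<longleftrightarrow>
    (\<forall>i j. i \<noteq> j \<and> cross3 (baseline (A $ i) (A $ j)) (ray (A $ j) (p $ j)) \<noteq> 0 \<longrightarrow>
      (principal_ray (A $ i) \<bullet> q) * q $ 4 \<ge> 0 \<and>
      (principal_ray (A $ i) \<bullet> q) * (principal_ray (A $ j) \<bullet> q) \<ge> 0)"
proof -
  have "(let b = baseline (A $ i) (A $ j); ai = ray (A $ i) (p $ i); aj = ray (A $ j) (p $ j) in
      det (left_block (A $ i)) * rep (p $ i) $ 3 * (cross3 ai aj \<bullet> cross3 b aj) \<ge> 0 \<and>
      det (left_block (A $ i)) * det (left_block (A $ j)) * rep (p $ i) $ 3 * rep (p $ j) $ 3
        * (cross3 b ai \<bullet> cross3 b aj) \<ge> 0) \<longleftrightarrow>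
     (cross3 (baseline (A $ i) (A $ j)) (ray (A $ j) (p $ j)) \<noteq> 0 \<longrightarrow>
      (principal_ray (A $ i) \<bullet> q) * q $ 4 \<ge> 0 \<and>
      (principal_ray (A $ i) \<bullet> q) * (principal_ray (A $ j) \<bullet> q) \<ge> 0)" if "i \<noteq> j" for i j
  proof -
    let ?m = "cross3 (baseline (A $ i) (A $ j)) (ray (A $ j) (p $ j))"
    have "center (A $ i) \<noteq> center (A $ j)" using inj that by (auto dest: injD)
    from C_set_terms[OF fin[rule_format] fin[rule_format] this \<open>q \<noteq> 0\<close> inc inc]
    obtain c where c: "c > 0" and eqs:
      "det (left_block (A $ i)) * rep (p $ i) $ 3
          * (cross3 (ray (A $ i) (p $ i)) (ray (A $ j) (p $ j)) \<bullet> ?m)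
        = c * ((principal_ray (A $ i) \<bullet> q) * q $ 4) * (?m \<bullet> ?m)"
      "det (left_block (A $ i)) * det (left_block (A $ j)) * rep (p $ i) $ 3 * rep (p $ j) $ 3
          * (cross3 (baseline (A $ i) (A $ j)) (ray (A $ i) (p $ i)) \<bullet> ?m)
        = c * ((principal_ray (A $ i) \<bullet> q) * (principal_ray (A $ j) \<bullet> q)) * (?m \<bullet> ?m)"
      by blast
    have sign: "c * x * (?m \<bullet> ?m) \<ge> 0 \<longleftrightarrow> (?m \<noteq> 0 \<longrightarrow> x \<ge> 0)" for x
    proof (cases "?m = 0")
      case False
      then have "c * (?m \<bullet> ?m) > 0" using c by simp
      then show ?thesis using False zero_le_mult_iff[of "c * (?m \<bullet> ?m)" x] by (simp add: mult_ac)
    qed simp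
    show ?thesis unfolding Let_def eqs sign by blast
  qed
  then show ?thesis unfolding C_set_rays by blast
qed

lemma C_set_signs:
  fixes A :: "camera^'m"
  assumes fin: "\<forall>i. finite_camera (A $ i)" and inj: "inj (\<lambda>i. center (A $ i))"
    and C: "p \<in> C_set A" and "q \<noteq> 0"
    and inc: "\<And>i. A $ i *v q \<noteq> 0 \<Longrightarrow> p $ i = pt (A $ i *v q)"
    and "i \<noteq> j" "cross3 (baseline (A $ i) (A $ j)) (ray (A $ j) (p $ j)) \<noteq> 0"
  shows "(principal_ray (A $ i) \<bullet> q) * q $ 4 \<ge> 0"
    and "(principal_ray (A $ i) \<bullet> q) * (principal_ray (A $ j) \<bullet> q) \<ge> 0"
  using C assms(6,7) by (subst (asm) C_set_incident_iff[OF fin inj \<open>q \<noteq> 0\<close> inc]; blast)+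

lemma visible_incidence_subset:
  fixes A :: "camera^'m"
  assumes fin: "\<forall>i. finite_camera (A $ i)" and inj: "inj (\<lambda>i. center (A $ i))"
  shows "incidence A (visible_cone A) \<subseteq> incidence A UNIV \<inter> C_set A"
proof
  fix p assume "p \<in> incidence A (visible_cone A)"
  then obtain q where q: "q \<in> visible_cone A" "q \<noteq> 0"
    "\<And>i. A $ i *v q \<noteq> 0 \<Longrightarrow> p $ i = pt (A $ i *v q)"
    unfolding incidence_def by auto
  then have "p \<in> C_set A"
    by (subst C_set_incident_iff[OF fin inj q(2,3)]) (auto simp: visible_cone_def)
  moreover have "p \<in> incidence A UNIV" using q unfolding incidence_def by auto
  ultimately show "p \<in> incidence A UNIV \<inter> C_set A" by blast
qed

lemma visible_incidenceI:
  fixes A :: "camera^'m"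
  assumes inc: "\<And>i. A $ i *v q \<noteq> 0 \<Longrightarrow> p $ i = pt (A $ i *v q)"
    and q: "q \<noteq> 0" "q \<in> visible_cone A \<or> - q \<in> visible_cone A"
  shows "p \<in> incidence A (visible_cone A)"
proof -
  have "p $ i = pt (A $ i *v - q)" if "A $ i *v - q \<noteq> 0" for i
  proof -
    have eq: "A $ i *v - q = (-1) *\<^sub>R (A $ i *v q)"
      using matrix_vector_mult_scaleR[of "A $ i" "-1" q] by simp
    with that inc[of i] show ?thesis unfolding eq by (subst pt_scaleR) auto
  qed
  with q inc show ?thesis unfolding incidence_def by (auto intro: bexI[of _ q] bexI[of _ "- q"])
qed

section \<open>Image points that satisfy the inequalities without being visible\<close>

text \<open>If camera \<open>i\<close> sees a finite point \<open>q\<close> from behind, then every inequality that pairs \<open>i\<close> with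
  another camera must be void. So the ray of every other camera runs along its baseline with \<open>i\<close>,
  and all centers lie on the line through \<open>q\<close> and the center of \<open>i\<close>.\<close>

lemma C_set_finite_exception:
  fixes A :: "camera^'m"
  assumes fin: "\<forall>i. finite_camera (A $ i)" and inj: "inj (\<lambda>i. center (A $ i))"
    and C: "p \<in> C_set A" and "q \<noteq> 0"
    and inc: "\<And>i. A $ i *v q \<noteq> 0 \<Longrightarrow> p $ i = pt (A $ i *v q)"
    and behind: "(principal_ray (A $ i) \<bullet> q) * q $ 4 < 0" and j0: "j0 \<noteq> i"
  shows "collinear_centers A" and "cross3 (baseline (A $ i) (A $ j0)) (ray (A $ k) (p $ k)) = 0"
proof -
  note signs = C_set_signs[OF fin inj C \<open>q \<noteq> 0\<close> inc]
  have vi: "view (A $ i) q \<noteq> 0"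
    using behind fin camera_eq_0_iff[of "A $ i" q] by (auto simp: principal_ray_inner)
  have on: "cross3 (baseline (A $ i) (A $ j)) (ray (A $ j) (p $ j)) = 0" if "j \<noteq> i" for j
    using signs(1)[of i j] behind that by force
  have "cross3 (view (A $ i) q) (baseline (A $ i) (A $ j)) = 0" if "j \<noteq> i" for j
  proof -
    have "cross3 (baseline (A $ i) (A $ j)) (view (A $ j) q) = 0"
    proof (cases "view (A $ j) q = 0")
      case False
      then obtain k where "k \<noteq> 0" "ray (A $ j) (p $ j) = k *\<^sub>R view (A $ j) q"
        using incident_ray[OF fin[rule_format] False inc] by metis
      then show ?thesis using on[OF that] by (simp add: cross_mult_right)
    qed simp
    then show ?thesis
      using view_baseline[of "A $ i" q "A $ j"] cross_skew[of "view (A $ j) q"]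
      by (simp add: cross_add_left cross_mult_left)
  qed
  then have "\<exists>s. baseline (A $ i) (A $ j) = s *\<^sub>R view (A $ i) q" if "j \<noteq> i" for j
    using cross3_eq_0_multiple[OF _ vi] that by metis
  moreover have "baseline (A $ i) (A $ i) = 0 *\<^sub>R view (A $ i) q" by (simp add: baseline_def)
  ultimately have "\<exists>s. baseline (A $ i) (A $ j) = s *\<^sub>R view (A $ i) q" for j by metis
  then obtain s where s: "\<And>j. baseline (A $ i) (A $ j) = s j *\<^sub>R view (A $ i) q" by metis
  have s_nz: "s j \<noteq> 0" if "j \<noteq> i" for j
    using s[of j] baseline_nonzero[OF inj, of i j] that by auto
  show "cross3 (baseline (A $ i) (A $ j0)) (ray (A $ k) (p $ k)) = 0"
  proof (cases "k = i")
    case True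
    obtain t where "ray (A $ i) (p $ i) = t *\<^sub>R view (A $ i) q"
      using incident_ray[OF fin[rule_format] vi inc] by metis
    then show ?thesis by (simp add: True s cross_mult_left cross_mult_right)
  next
    case False
    then have "cross3 (view (A $ i) q) (ray (A $ k) (p $ k)) = 0"
      using on[OF False] s_nz[OF False] by (simp add: s cross_mult_left)
    then show ?thesis by (simp add: s cross_mult_left)
  qed
  let ?c = "\<lambda>j. center_vec (A $ j)"
  let ?S = "span {q, ?c i}"
  have "q \<notin> span {?c i}"
    using vi by (auto simp: span_singleton view_linear view_center)
  then have "dim ?S = 2" by (simp add: dim_insert dim_singleton)
  moreover have "?c j \<in> ?S" for j
  proof -
    have "?c j = ?c i + s j *\<^sub>R (q - q $ 4 *\<^sub>R ?c i)"
      using s[of j] by (simp add: vec4_eq_iff baseline_def view_def algebra_simps)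
    also have "\<dots> \<in> ?S"
      by (intro span_add span_scale span_diff span_base) auto
    finally show ?thesis .
  qed
  then have "centers A \<subseteq> pt ` (?S - {0})" by (auto simp: centers_def center_def)
  ultimately show "collinear_centers A"
    unfolding collinear_centers_def proj_line_def by (metis subspace_span)
qed

text \<open>If two cameras see an ideal point \<open>q\<close> with opposite signs, then \<open>q\<close> must be the direction of their
  baseline. The sign of a camera off that baseline is compared with both of these signs, so it
  can only be zero.\<close>

lemma C_set_ideal_exception:
  fixes A :: "camera^'m"
  assumes fin: "\<forall>i. finite_camera (A $ i)" and inj: "inj (\<lambda>i. center (A $ i))"
    and C: "p \<in> C_set A" and "q \<noteq> 0" and w: "q $ 4 = 0"
    and inc: "\<And>i. A $ i *v q \<noteq> 0 \<Longrightarrow> p $ i = pt (A $ i *v q)"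
    and k: "principal_ray (A $ k) \<bullet> q > 0" and l: "principal_ray (A $ l) \<bullet> q < 0"
  shows "undecided_baseline A k l" and "cross3 (baseline (A $ k) (A $ l)) (ray (A $ j) (p $ j)) = 0"
proof -
  note signs = C_set_signs[OF fin inj C \<open>q \<noteq> 0\<close> inc]
  have "k \<noteq> l" using k l by auto
  have view: "view (A $ i) q = xyz q" for i by (simp add: view_def w)
  have x: "xyz q \<noteq> 0" using \<open>q \<noteq> 0\<close> w by (simp add: vec4_eq_iff)
  have ray: "cross3 b (ray (A $ i) (p $ i)) = 0 \<longleftrightarrow> cross3 b (xyz q) = 0" for b i
  proof -
    obtain t where "t \<noteq> 0" "ray (A $ i) (p $ i) = t *\<^sub>R xyz q"
      using incident_ray[OF fin[rule_format] _ inc, of i] x unfolding view by metis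
    then show ?thesis by (simp add: cross_mult_right)
  qed
  have "cross3 (baseline (A $ k) (A $ l)) (ray (A $ l) (p $ l)) = 0"
  proof (rule ccontr)
    assume "\<not> ?thesis"
    then have "(principal_ray (A $ k) \<bullet> q) * (principal_ray (A $ l) \<bullet> q) \<ge> 0"
      using signs(2)[of k l] \<open>k \<noteq> l\<close> by blast
    then show False using mult_pos_neg[OF k l] by linarith
  qed
  then have kl: "cross3 (baseline (A $ k) (A $ l)) (xyz q) = 0" unfolding ray .
  then show "cross3 (baseline (A $ k) (A $ l)) (ray (A $ j) (p $ j)) = 0" unfolding ray .
  have parallel: "\<exists>s. b = s *\<^sub>R xyz q" if "cross3 b (xyz q) = 0" for b
    using cross3_eq_0_multiple[OF _ x, of b] cross_skew[of b] that by force
  then obtain s where s: "baseline (A $ k) (A $ l) = s *\<^sub>R xyz q" using kl by blast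
  have "s \<noteq> 0" using s baseline_nonzero[OF inj \<open>k \<noteq> l\<close>] by auto
  let ?c = "\<lambda>j. center_vec (A $ j)"
  have d: "?c k - ?c l = (- s) *\<^sub>R q"
    using s w by (simp add: vec4_eq_iff baseline_def algebra_simps)
  have off: "cross3 (baseline (A $ i) (A $ j)) (ray (A $ j) (p $ j)) \<noteq> 0"
    if "?c j \<notin> span {?c k, ?c l}" "i \<in> {k, l}" for i j
  proof
    assume "cross3 (baseline (A $ i) (A $ j)) (ray (A $ j) (p $ j)) = 0"
    then obtain t where t: "baseline (A $ i) (A $ j) = t *\<^sub>R xyz q" unfolding ray using parallel by blast
    have "?c j = ?c i + t *\<^sub>R q"
      using t w by (simp add: vec4_eq_iff baseline_def algebra_simps)
    also have "q = (- 1 / s) *\<^sub>R (?c k - ?c l)" using \<open>s \<noteq> 0\<close> unfolding d by simp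
    finally have "?c j = ?c i + t *\<^sub>R ((- 1 / s) *\<^sub>R (?c k - ?c l))" .
    also have "\<dots> \<in> span {?c k, ?c l}"
      using that(2) by (intro span_add span_scale span_diff) (auto intro: span_base)
    finally show False using that(1) by blast
  qed
  have "principal_ray (A $ j) \<bullet> q = 0" if "?c j \<notin> span {?c k, ?c l}" for j
  proof -
    have "j \<noteq> k" "j \<noteq> l" using that by (auto intro: span_base)
    then have "(principal_ray (A $ k) \<bullet> q) * (principal_ray (A $ j) \<bullet> q) \<ge> 0"
      "(principal_ray (A $ l) \<bullet> q) * (principal_ray (A $ j) \<bullet> q) \<ge> 0"
      using signs(2)[of k j] signs(2)[of l j] off[OF that] by blast+
    then show ?thesis using k l by (auto simp: zero_le_mult_iff)
  qed
  then show "undecided_baseline A k l"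
    using k l \<open>s \<noteq> 0\<close> unfolding undecided_baseline_def Let_def d
    by (auto simp: mult_less_0_iff zero_less_mult_iff)
qed

text \<open>In both exceptional cases, every ray is parallel to one and the same baseline. A single camera
  imposes no inequality at all; there the center itself is visible and every \<open>p\<close> is incident with
  it.\<close>

lemma C_set_dichotomy:
  fixes A :: "camera^'m"
  assumes fin: "\<forall>i. finite_camera (A $ i)" and inj: "inj (\<lambda>i. center (A $ i))"
    and "p \<in> incidence A UNIV" and C: "p \<in> C_set A"
  shows "p \<in> incidence A (visible_cone A) \<or>
    (collinear_centers A \<or> (\<exists>k l. undecided_baseline A k l)) \<and>
    (\<exists>i j. i \<noteq> j \<and> (\<forall>k. cross3 (baseline (A $ i) (A $ j)) (ray (A $ k) (p $ k)) = 0))"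
proof -
  obtain q where q: "q \<noteq> 0" "\<And>i. A $ i *v q \<noteq> 0 \<Longrightarrow> p $ i = pt (A $ i *v q)"
    using assms(3) unfolding incidence_def by auto
  consider (visible) "q \<in> visible_cone A \<or> - q \<in> visible_cone A"
    | (behind) i where "(principal_ray (A $ i) \<bullet> q) * q $ 4 < 0"
    | (ideal) k l where "q $ 4 = 0" "principal_ray (A $ k) \<bullet> q > 0" "principal_ray (A $ l) \<bullet> q < 0"
  proof -
    have "\<exists>i. (principal_ray (A $ i) \<bullet> q) * q $ 4 < 0"
      if "q \<notin> visible_cone A" "- q \<notin> visible_cone A" "q $ 4 \<noteq> 0"
      using that unfolding visible_cone_def
      by (cases "q $ 4 > 0") (auto simp: mult_less_0_iff not_le)
    moreover have "\<exists>k l. principal_ray (A $ k) \<bullet> q > 0 \<and> principal_ray (A $ l) \<bullet> q < 0"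
      if "q \<notin> visible_cone A" "- q \<notin> visible_cone A" "q $ 4 = 0"
      using that unfolding visible_cone_def by (auto simp: not_le)
    ultimately show ?thesis using that by metis
  qed
  then show ?thesis
  proof cases
    case visible
    then show ?thesis using visible_incidenceI[OF q(2,1)] by blast
  next
    case (behind i)
    show ?thesis
    proof (cases "\<exists>j. j \<noteq> i")
      case True
      then obtain j where "j \<noteq> i" by blast
      with C_set_finite_exception[OF fin inj C q behind] show ?thesis by metis
    next
      case False
      then have only: "j = i" for j by blast
      have Ai: "A $ j *v center_vec (A $ i) = 0" for j
        using fin by (simp add: only[of j] camera_eq_0_iff view_center)
      then have "center_vec (A $ i) \<in> visible_cone A"
        by (simp add: visible_cone_def principal_ray_inner)
      then have "p \<in> incidence A (visible_cone A)"
        using visible_incidenceI[of A "center_vec (A $ i)" p] Ai by simp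
      then show ?thesis ..
    qed
  next
    case (ideal k l)
    have "k \<noteq> l" using ideal by auto
    with C_set_ideal_exception[OF fin inj C q(1) ideal(1) q(2) ideal(2,3)] show ?thesis by metis
  qed
qed

section \<open>The image of a common baseline\<close>

lemma proj_line_subspace:
  assumes "proj_line L"
  obtains S where "subspace S" "dim S = 2" "\<And>v. v \<noteq> 0 \<Longrightarrow> pt v \<in> L \<longleftrightarrow> v \<in> S"
proof -
  obtain S where S: "subspace S" "dim S = 2" "L = pt ` (S - {0})"
    using assms unfolding proj_line_def by blast
  have "v \<in> S" if v: "v \<noteq> 0" "pt v \<in> L" for v
  proof -
    obtain s where "s \<in> S" "s \<noteq> 0" "pt v = pt s" using v S(3) by auto
    then obtain k where "v = k *\<^sub>R s" using pt_eq_iff[of v s] v(1) by auto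
    with S(1) \<open>s \<in> S\<close> show ?thesis by (simp add: subspace_scale)
  qed
  moreover have "pt v \<in> L" if "v \<noteq> 0" "v \<in> S" for v using that S(3) by blast
  ultimately show ?thesis using that[OF S(1,2)] by blast
qed

text \<open>A camera contracts a line through its center to one image point.\<close>

lemma view_plane_through_center:
  assumes S: "subspace S" "dim S = 2" and c: "center_vec A \<in> S"
    and q: "q \<in> S" "view A q \<noteq> 0" and z: "z \<in> S"
  obtains t where "view A z = t *\<^sub>R view A q"
proof -
  let ?T = "span {q, center_vec A}"
  have "q \<notin> span {center_vec A}"
    using q(2) by (auto simp: span_singleton view_linear view_center)
  then have "dim ?T = 2" by (simp add: dim_insert dim_singleton)
  moreover have "?T \<subseteq> S" using S(1) c q(1) by (simp add: span_minimal)
  ultimately have "?T = S"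
    using S by (intro subspace_dim_equal) (auto simp: subspace_span)
  with z obtain t where "z - t *\<^sub>R q \<in> span {center_vec A}" by (auto simp: span_insert)
  then obtain s where "z - t *\<^sub>R q = s *\<^sub>R center_vec A" by (auto simp: span_singleton)
  then have "view A (z - t *\<^sub>R q) = 0" by (simp add: view_linear view_center)
  then show ?thesis using that[of t] by (simp add: view_linear)
qed

lemma pt_camera_eqI:
  assumes fin: "finite_camera A" and "view A q \<noteq> 0" and p: "ray A p = t *\<^sub>R view A q"
  shows "p = pt (A *v q)"
proof -
  have "t \<noteq> 0" using ray_nonzero[OF fin, of p] p by auto
  have "rep p = left_block A *v ray A p"
    using fin by (simp add: ray_def finite_camera_inverse)
  also have "\<dots> = t *\<^sub>R (A *v q)" using fin by (simp add: p camera_mult matrix_vector_mult_scaleR)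
  finally have "pt (rep p) = pt (t *\<^sub>R (A *v q))" by simp
  then show ?thesis using \<open>t \<noteq> 0\<close> by (simp add: pt_scaleR)
qed

text \<open>Along a line that contains all centers, every view is parallel to the baselines, so every
  inequality is void. The last part applies also when the only visible points of the line are
  centers: then the image of the line belongs to the sets \<open>E_set A j\<close> of these centers.\<close>

lemma common_baseline:
  fixes A :: "camera^'m"
  assumes fin: "\<forall>i. finite_camera (A $ i)" and inj: "inj (\<lambda>i. center (A $ i))"
    and L: "proj_line L" "centers A \<subseteq> L" and q: "q \<in> L - centers A"
  shows baseline_image_in_C_set: "phi A q \<in> incidence A UNIV \<inter> C_set A"
    and baseline_image_unique: "\<lbrakk>i \<noteq> j; \<And>k. cross3 (baseline (A $ i) (A $ j)) (ray (A $ k) (p $ k)) = 0\<rbrakk>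
      \<Longrightarrow> p = phi A q"
    and baseline_image_visible: "L \<inter> chiral_domain A \<noteq> {} \<Longrightarrow> phi A q \<in> incidence A (visible_cone A)"
proof -
  obtain S where S: "subspace S" "dim S = 2" "\<And>v. v \<noteq> 0 \<Longrightarrow> pt v \<in> L \<longleftrightarrow> v \<in> S"
    using proj_line_subspace[OF L(1)] by blast
  have cS: "center_vec (A $ i) \<in> S" for i
    using L(2) S(3)[of "center_vec (A $ i)"] by (auto simp: centers_def center_def)
  have qS: "rep q \<in> S" using q S(3)[of "rep q"] by simp
  have vq: "view (A $ i) (rep q) \<noteq> 0" for i
    using q pt_eq_center_iff[of "rep q" "A $ i"] by (auto simp: centers_def)
  have phi: "phi A q $ i = pt (A $ i *v rep q)" for i by (simp add: phi_def cam_image_def)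
  have multiple: "\<exists>t. view (A $ i) z = t *\<^sub>R view (A $ i) (rep q)" if z: "z \<in> S" for i z
    using view_plane_through_center[OF S(1,2) cS qS vq z] by metis
  have base: "\<exists>t. baseline (A $ i) (A $ j) = t *\<^sub>R view (A $ k) (rep q)" for i j k
  proof -
    have "center_vec (A $ j) - center_vec (A $ i) \<in> S" using S(1) cS by (simp add: subspace_diff)
    moreover have "view (A $ k) (center_vec (A $ j) - center_vec (A $ i)) = baseline (A $ i) (A $ j)"
      by (simp add: view_def baseline_def)
    ultimately show ?thesis using multiple by metis
  qed
  have "cross3 (baseline (A $ i) (A $ j)) (ray (A $ j) (phi A q $ j)) = 0" for i j
  proof -
    obtain t where "ray (A $ j) (phi A q $ j) = t *\<^sub>R view (A $ j) (rep q)"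
      using incident_ray[OF fin[rule_format] vq, of j "phi A q $ j"] phi by metis
    moreover obtain s where "baseline (A $ i) (A $ j) = s *\<^sub>R view (A $ j) (rep q)"
      using base by blast
    ultimately show ?thesis by (simp add: cross_mult_left cross_mult_right)
  qed
  then have "phi A q \<in> C_set A"
    by (subst C_set_incident_iff[OF fin inj rep_nonzero phi]) simp
  then show "phi A q \<in> incidence A UNIV \<inter> C_set A"
    using phi unfolding incidence_def by (auto intro!: bexI[of _ "rep q"])
  show "p = phi A q"
    if "i \<noteq> j" and p: "\<And>k. cross3 (baseline (A $ i) (A $ j)) (ray (A $ k) (p $ k)) = 0" for i j
  proof -
    have "p $ k = pt (A $ k *v rep q)" for k
    proof -
      obtain t where t: "baseline (A $ i) (A $ j) = t *\<^sub>R view (A $ k) (rep q)" using base by blast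
      obtain s where "ray (A $ k) (p $ k) = s *\<^sub>R baseline (A $ i) (A $ j)"
        using cross3_eq_0_multiple[OF p baseline_nonzero[OF inj \<open>i \<noteq> j\<close>]] by blast
      then have "ray (A $ k) (p $ k) = (s * t) *\<^sub>R view (A $ k) (rep q)" by (simp add: t)
      then show ?thesis using fin by (intro pt_camera_eqI vq) auto
    qed
    then show ?thesis by (simp add: vec_eq_iff phi)
  qed
  show "phi A q \<in> incidence A (visible_cone A)" if meets: "L \<inter> chiral_domain A \<noteq> {}"
  proof -
    have "chiral_domain A \<noteq> {}" using meets by blast
    from meets obtain z where z: "z \<in> visible_cone A" "z \<noteq> 0" "z \<in> S"
      unfolding chiral_domain_eq[OF fin \<open>chiral_domain A \<noteq> {}\<close>] using S(3) by blast
    have "phi A q $ i = pt (A $ i *v z)" if "A $ i *v z \<noteq> 0" for i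
    proof -
      obtain t where "view (A $ i) z = t *\<^sub>R view (A $ i) (rep q)" using multiple[OF z(3)] by blast
      then have "A $ i *v z = t *\<^sub>R (A $ i *v rep q)"
        using fin by (simp add: camera_mult matrix_vector_mult_scaleR)
      then show ?thesis using that phi[of i] pt_scaleR[of t "A $ i *v rep q"] by auto
    qed
    then show ?thesis using z unfolding incidence_def by blast
  qed
qed

lemma line_point_off_centers:
  fixes A :: "camera^'m"
  assumes L: "proj_line L" "centers A \<subseteq> L"
  shows "L - centers A \<noteq> {}"
proof -
  obtain S where S: "subspace S" "dim S = 2" "\<And>v. v \<noteq> 0 \<Longrightarrow> pt v \<in> L \<longleftrightarrow> v \<in> S"
    using proj_line_subspace[OF L(1)] by blast
  let ?c = "center_vec (A $ undefined)"
  have cS: "?c \<in> S" using L(2) S(3)[of ?c] by (auto simp: centers_def center_def)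
  have "\<not> S \<subseteq> span {?c}"
    using S(2) dim_subset[of S "span {?c}"] by (auto simp: dim_singleton)
  then obtain s where s: "s \<in> S" "s \<notin> span {?c}" by blast
  \<comment> \<open>The ideal point of the line; centers are finite.\<close>
  define q where "q = s - s $ 4 *\<^sub>R ?c"
  have "q \<in> S" using s cS S(1) by (simp add: q_def subspace_diff subspace_scale)
  have "q $ 4 = 0" by (simp add: q_def)
  have "q \<noteq> 0" using s(2) by (auto simp: q_def span_singleton)
  have "pt q \<noteq> center (A $ i)" for i
    using \<open>q \<noteq> 0\<close> \<open>q $ 4 = 0\<close> by (simp add: pt_eq_center_iff view_eq_0_iff)
  then have "pt q \<in> L - centers A"
    using S(3) \<open>q \<noteq> 0\<close> \<open>q \<in> S\<close> by (auto simp: centers_def)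
  then show ?thesis by blast
qed

theorem theorem5:
  fixes A :: "camera^'m"
  assumes "\<forall>i. finite_camera (A $ i)"
    and "inj (\<lambda>i. center (A $ i))"
    and "chiral_domain A \<noteq> {}"
  shows
    "(E_zero A = {} \<and> decided_baselines A \<longrightarrow>
        closure (joint_image A) \<inter> C_set A = closure (chiral_joint_image A)) \<and>
     (E_zero A \<noteq> {} \<and> \<not> collinear_centers A \<longrightarrow>
        (decided_baselines A \<longrightarrow>
           closure (joint_image A) \<inter> C_set A = chiral_joint_image A \<union> E_plus A) \<and>
        chiral_joint_image A \<union> E_plus A = closure (chiral_joint_image A) \<union> E_zero A) \<and>
     (\<forall>L q. proj_line L \<and> centers A \<subseteq> L \<and> q \<in> L - centers A \<longrightarrow>
        closure (joint_image A) \<inter> C_set A = chiral_joint_image A \<union> E_plus A \<union> {phi A q} \<and>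
        chiral_joint_image A \<union> E_plus A \<union> {phi A q}
          = closure (chiral_joint_image A) \<union> E_zero A \<union> {phi A q})"
proof -
  note closure_X = closure_chiral_joint_image[OF assms]
  let ?V = "chiral_joint_image A \<union> E_plus A"
  have visible: "?V \<subseteq> closure (joint_image A) \<inter> C_set A"
    using visible_incidence_subset[OF assms(1,2)]
    unfolding closure_joint_image[OF assms(1,2)] chiral_incidence[OF assms] .
  note dichotomy = C_set_dichotomy[OF assms(1,2), folded closure_joint_image[OF assms(1,2)],
      unfolded chiral_incidence[OF assms]]
  have line: "closure (joint_image A) \<inter> C_set A = ?V \<union> {phi A q}"
    if L: "proj_line L" "centers A \<subseteq> L" "q \<in> L - centers A" for L q
  proof
    show "closure (joint_image A) \<inter> C_set A \<subseteq> ?V \<union> {phi A q}"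
      using dichotomy baseline_image_unique[OF assms(1,2) L] by blast
    show "?V \<union> {phi A q} \<subseteq> closure (joint_image A) \<inter> C_set A"
      using visible baseline_image_in_C_set[OF assms(1,2) L]
      unfolding closure_joint_image[OF assms(1,2)] by blast
  qed
  have decided: "closure (joint_image A) \<inter> C_set A = ?V" if dec: "decided_baselines A"
  proof (cases "collinear_centers A")
    case True
    then obtain L where L: "proj_line L" "centers A \<subseteq> L" "L \<inter> chiral_domain A \<noteq> {}"
      using dec unfolding decided_baselines_def by auto
    obtain q where q: "q \<in> L - centers A" using line_point_off_centers[OF L(1,2)] by blast
    have "phi A q \<in> ?V"
      using baseline_image_visible[OF assms(1,2) L(1,2) q L(3)] unfolding chiral_incidence[OF assms] .
    with line[OF L(1,2) q] show ?thesis by blast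
  next
    case False
    then have "\<not> undecided_baseline A i j" for i j using dec unfolding decided_baselines_def by auto
    with dichotomy False visible show ?thesis by blast
  qed
  show ?thesis
    using decided line closure_X by auto
qed

end
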